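(* Let $G$ be a looped simple graph and $r$ the rank function of $M(IAS(G))$. Suppose $S$ is a subtransversal of $W(G)$ with $|S|=|V(G)|-1$, and let $v$ be the vertex of $G$ with $v_\phi,v_\chi,v_\psi\notin S$. Let $S_\phi=S\cup\{v_\phi\}$, $S_\chi=S\cup\{v_\chi\}$, $S_\psi=S\cup\{v_\psi\}$. Then one of $S_\phi,S_\chi,S_\psi$ has rank $r(S)$, and the other two have rank $r(S)+1$.
   Context: A looped simple graph is a finite graph in which each vertex may carry at most one loop and distinct non-loop edges join distinct pairs of vertices. $A(G)$ is the adjacency matrix over $GF(2)$ (diagonal $1$ iff looped). $M(IAS(G))$ is the binary matroid represented by the columns of $(I\mid A(G)\mid I+A(G))$; its ground set $W(G)$ consists of columns $w_\phi,w_\chi,w_\psi$ for $w\in V(G)$, the columns of $w$ in $I$, $A(G)$, $I+A(G)$. A subtransversal of $W(G)$ is a subset $S\subseteq W(G)$ with $|S\cap\{w_\phi,w_\chi,w_\psi\}|\le 1$ for all $w\in V(G)$. *)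

theory Defs
  imports "HOL-Analysis.Cartesian_Space" "HOL-Library.Z2"
begin

section \<open>Looped simple graphs\<close>

text \<open>The vertex set is a finite type and a graph is given by its set of edges. The edge joining
  \<open>u\<close> and \<open>w\<close> is the set \<open>{u, w}\<close>, so that a loop at \<open>w\<close> is the singleton \<open>{w}\<close>.\<close>

definition looped_simple_graph :: "'v::finite set set \<Rightarrow> bool" where
  "looped_simple_graph E \<longleftrightarrow> (\<forall>e\<in>E. card e = 1 \<or> card e = 2)"

text \<open>On the diagonal \<open>{u, w}\<close> is \<open>{u}\<close>, so the entry is 1 iff \<open>u\<close> is looped.\<close>

definition adjacency_matrix :: "'v::finite set set \<Rightarrow> bit ^ 'v ^ 'v" where
  "adjacency_matrix E = (\<chi> u w. if {u, w} \<in> E then 1 else 0)"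


section \<open>Matroids represented by the columns of a matrix\<close>

text \<open>A matroid is given by its ground set and its family of independent sets.\<close>

type_synonym 'e matroid = "'e set \<times> 'e set set"

definition is_matroid :: "'e matroid \<Rightarrow> bool" where
  "is_matroid M \<longleftrightarrow> (case M of (W, \<I>) \<Rightarrow>
     finite W \<and> (\<forall>I\<in>\<I>. I \<subseteq> W) \<and> {} \<in> \<I> \<and>
     (\<forall>I\<in>\<I>. \<forall>J. J \<subseteq> I \<longrightarrow> J \<in> \<I>) \<and>
     (\<forall>I\<in>\<I>. \<forall>J\<in>\<I>. card I < card J \<longrightarrow> (\<exists>x\<in>J - I. insert x I \<in> \<I>)))"

definition matroid_rank :: "'e matroid \<Rightarrow> 'e set \<Rightarrow> nat" where
  "matroid_rank M X = Max {card I | I. I \<in> snd M \<and> I \<subseteq> X}"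

text \<open>The ground set consists of the column indices, and equal columns at different indices are
  parallel elements; hence the injectivity condition: the columns must be linearly independent as
  an indexed family.\<close>

definition column_matroid :: "'a::field ^ 'c ^ 'r \<Rightarrow> ('c::finite) matroid" where
  "column_matroid A = (UNIV,
     {I. inj_on (\<lambda>c. column c A) I \<and> vec.independent ((\<lambda>c. column c A) ` I)})"

lemma is_matroid_column_matroid: "is_matroid (column_matroid A)"
proof -
  let ?f = "\<lambda>c. column c A"
  have augment: "\<exists>x\<in>J - I. inj_on ?f (insert x I) \<and> vec.independent (?f ` insert x I)"
    if I: "inj_on ?f I" "vec.independent (?f ` I)"
      and J: "inj_on ?f J" "vec.independent (?f ` J)"
      and less: "card I < card J" for I J
  proof -
    have "card (?f ` I) < card (?f ` J)"
      using I(1) J(1) less by (simp add: card_image)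
    then have "\<not> ?f ` J \<subseteq> vec.span (?f ` I)"
      using vec.independent_span_bound[of "?f ` I" "?f ` J"] J(2) by fastforce
    then obtain x where x: "x \<in> J" "?f x \<notin> vec.span (?f ` I)"
      by (auto simp only: image_subset_iff)
    then have new: "?f x \<notin> ?f ` I"
      using vec.span_base[of "?f x" "?f ` I"] by meson
    have "inj_on ?f (insert x I)"
      using I(1) new by auto
    moreover have "vec.independent (?f ` insert x I)"
      using x(2) I(2) by (simp only: image_insert vec.independent_insertI simp_thms)
    ultimately show ?thesis
      using x(1) new by (intro bexI[of _ x]) auto
  qed
  have subset: "inj_on ?f J \<and> vec.independent (?f ` J)"
    if "inj_on ?f I" "vec.independent (?f ` I)" "J \<subseteq> I" for I J
    using that vec.independent_mono[OF that(2) image_mono[OF that(3)]] inj_on_subset by blast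
  let ?\<I> = "{I. inj_on ?f I \<and> vec.independent (?f ` I)}"
  have "{} \<in> ?\<I>"
    using vec.independent_empty by simp
  moreover have "\<forall>I\<in>?\<I>. \<forall>J. J \<subseteq> I \<longrightarrow> J \<in> ?\<I>"
    using subset by blast
  moreover have "\<forall>I\<in>?\<I>. \<forall>J\<in>?\<I>. card I < card J \<longrightarrow> (\<exists>x\<in>J - I. insert x I \<in> ?\<I>)"
    unfolding mem_Collect_eq by (intro ballI impI, unfold mem_Collect_eq, elim conjE) (rule augment)
  ultimately show ?thesis
    unfolding is_matroid_def column_matroid_def case_prod_conv
    by (simp only: finite subset_UNIV ball_triv simp_thms)
qed


section \<open>The isotropic matroid\<close>

datatype column_kind = Phi | Chi | Psi

instance column_kind :: finite
proof
  have "(UNIV :: column_kind set) = {Phi, Chi, Psi}"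
    using column_kind.exhaust by auto
  then show "finite (UNIV :: column_kind set)"
    by (metis finite.emptyI finite.insertI)
qed

text \<open>The matrix \<open>(I | A(G) | I + A(G))\<close>, where \<open>(w, Phi)\<close>, \<open>(w, Chi)\<close>, \<open>(w, Psi)\<close> index the columns
  of \<open>w\<close> in the three blocks.\<close>

definition IAS :: "'v::finite set set \<Rightarrow> bit ^ ('v \<times> column_kind) ^ 'v" where
  "IAS E = (\<chi> u c. case c of
     (w, Phi) \<Rightarrow> mat 1 $ u $ w
   | (w, Chi) \<Rightarrow> adjacency_matrix E $ u $ w
   | (w, Psi) \<Rightarrow> (mat 1 + adjacency_matrix E) $ u $ w)"

abbreviation M_IAS :: "'v::finite set set \<Rightarrow> ('v \<times> column_kind) matroid" where
  "M_IAS E \<equiv> column_matroid (IAS E)"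

definition subtransversal :: "('v::finite \<times> column_kind) set \<Rightarrow> bool" where
  "subtransversal S \<longleftrightarrow> (\<forall>w. card (S \<inter> {(w, Phi), (w, Chi), (w, Psi)}) \<le> 1)"

end

theory Submission
  imports Defs
begin

text \<open>Put \<open>A = adjacency_matrix E\<close> and send a vector \<open>z\<close> to the pairs \<open>(z\<^sub>w, (A z)\<^sub>w)\<close>. As \<open>A\<close> is
  symmetric, these vectors of pairs form an isotropic subspace for the symplectic form
  \<open>\<Sum>w. z\<^sub>w (A z')\<^sub>w + (A z)\<^sub>w z'\<^sub>w\<close>. If \<open>z\<close> and \<open>z'\<close> are orthogonal to the columns in \<open>S\<close>, then
  their pairs at each \<open>w \<noteq> v\<close> lie on a common line, so the form reduces to its term at \<open>v\<close>, and
  the pairs at \<open>v\<close> lie on a line as well. A column at \<open>v\<close> vanishes on this line, and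
  so belongs to the span of \<open>S\<close>. Conversely, a representation \<open>e\<^sub>v = x + A y\<close> of the column
  \<open>v\<^sub>\<phi>\<close> in that span yields the vector \<open>y\<close>, which is orthogonal to \<open>S\<close> but not to \<open>v\<^sub>\<chi>\<close>.\<close>

section \<open>Column matroids and linear algebra\<close>

text \<open>A basis chosen among the columns over \<open>X\<close> lifts to indices on which the
  column map is injective, so the dimension is attained. Injectivity on independent index sets makes
  it an upper bound too.\<close>

lemma matroid_rank_column_matroid:
  "matroid_rank (column_matroid A) X = vec.dim ((\<lambda>c. column c A) ` X)"
proof -
  let ?f = "\<lambda>c. column c A"
  have mem: "I \<in> snd (column_matroid A) \<longleftrightarrow> inj_on ?f I \<and> vec.independent (?f ` I)" for I
    by (simp add: column_matroid_def)
  let ?C = "{card I | I. I \<in> snd (column_matroid A) \<and> I \<subseteq> X}"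
  obtain B where B: "B \<subseteq> ?f ` X" "vec.independent B" "card B = vec.dim (?f ` X)"
    using vec.basis_exists[of "?f ` X"] by metis
  obtain I where I: "I \<subseteq> X" "inj_on ?f I" "B = ?f ` I"
    using B(1) by (meson subset_image_inj)
  have "vec.dim (?f ` X) \<in> ?C"
    using I B(2,3) mem by (auto simp: card_image intro!: exI[of _ I])
  moreover have "y \<le> vec.dim (?f ` X)" if "y \<in> ?C" for y
  proof -
    obtain I where I: "y = card I" "inj_on ?f I" "vec.independent (?f ` I)" "I \<subseteq> X"
      using \<open>y \<in> ?C\<close> mem by blast
    have "card (?f ` I) = vec.dim (?f ` I)"
      using vec.dim_eq_card_independent[OF I(3)] by simp
    also have "\<dots> \<le> vec.dim (?f ` X)"
      by (intro vec.dim_subset image_mono I(4))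
    finally show ?thesis
      using I(1,2) by (simp add: card_image)
  qed
  moreover have "finite ?C"
    by (rule finite_subset[of _ "card ` UNIV"]) auto
  ultimately show ?thesis
    unfolding matroid_rank_def by (intro Max_eqI)
qed

lemma matroid_rank_column_matroid_insert:
  "matroid_rank (column_matroid A) (S \<union> {c}) = matroid_rank (column_matroid A) S +
     (if column c A \<in> vec.span ((\<lambda>c. column c A) ` S) then 0 else 1)"
  by (simp add: matroid_rank_column_matroid vec.dim_insert)

text \<open>Writes a coordinate of a linear map as a dot product with a fixed vector, which turns a
  separating functional into a row vector.\<close>

lemma vec_linear_functional_eq_sum:
  fixes f :: "'a::field ^ 'n \<Rightarrow> 'a ^ 'm"
  assumes "Vector_Spaces.linear (*s) (*s) f"
  shows "f x $ i = (\<Sum>j\<in>UNIV. x $ j * f (axis j 1) $ i)"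
proof -
  have "f x = matrix f *v x"
    using matrix_works[OF assms] by simp
  then show ?thesis
    by (simp add: matrix_vector_mult_def matrix_def mult.commute)
qed

text \<open>This is duality: the entries of \<open>z v* A\<close> are the pairings of
  \<open>z\<close> with the columns, and a column outside the span is separated from it by a linear
  functional.\<close>

lemma column_in_span_iff:
  fixes A :: "'a::field ^ 'c ^ 'r"
  shows "column c A \<in> vec.span ((\<lambda>c. column c A) ` S) \<longleftrightarrow>
    (\<forall>z. (\<forall>s\<in>S. (z v* A) $ s = 0) \<longrightarrow> (z v* A) $ c = 0)"
    (is "?f c \<in> vec.span (?f ` S) \<longleftrightarrow> _")
proof
  assume c: "?f c \<in> vec.span (?f ` S)"
  show "\<forall>z. (\<forall>s\<in>S. (z v* A) $ s = 0) \<longrightarrow> (z v* A) $ c = 0"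
  proof (intro allI impI)
    fix z assume z: "\<forall>s\<in>S. (z v* A) $ s = 0"
    have "(\<Sum>u\<in>UNIV. ?f c $ u * z $ u) = 0"
      using c
    proof (induction rule: vec.span_induct)
      case base
      show ?case
        by (auto simp: vec.subspace_def algebra_simps sum.distrib
            simp flip: sum_distrib_left)
    next
      case (step x)
      then show ?case
        using z by (auto simp: vector_matrix_mult_def column_def mult.commute)
    qed
    then show "(z v* A) $ c = 0"
      by (simp add: vector_matrix_mult_def column_def mult.commute)
  qed
next
  assume *: "\<forall>z. (\<forall>s\<in>S. (z v* A) $ s = 0) \<longrightarrow> (z v* A) $ c = 0"
  show "?f c \<in> vec.span (?f ` S)"
  proof (rule ccontr)
    assume c: "?f c \<notin> vec.span (?f ` S)"
    obtain B where B: "B \<subseteq> ?f ` S" "vec.independent B" "?f ` S \<subseteq> vec.span B"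
      using vec.basis_exists[of "?f ` S"] by metis
    have notin: "?f c \<notin> vec.span B"
      using c vec.span_mono[OF B(1)] by blast
    then have ind: "vec.independent (insert (?f c) B)"
      using B(2) by (simp add: vec.independent_insertI)
    \<comment> \<open>The functional is encoded as a vector-valued map whose value \<open>1\<close>
      is the all-ones vector, so any coordinate \<open>i\<close> of \<open>g\<close> serves as the
      scalar functional.\<close>
    obtain g :: "'a ^ 'r \<Rightarrow> 'a ^ 'r" where g: "Vector_Spaces.linear (*s) (*s) g"
      and gB: "\<forall>x\<in>insert (?f c) B. g x = (if x = ?f c then 1 else 0)"
      using vec.linear_independent_extend[OF ind, of "\<lambda>x. if x = ?f c then 1 else 0"] by blast
    fix i :: 'r
    let ?z = "\<chi> u. g (axis u 1) $ i"
    have z: "(?z v* A) $ s = g (?f s) $ i" for s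
      unfolding vec_linear_functional_eq_sum[OF g, of "?f s"]
      by (simp add: vector_matrix_mult_def column_def mult.commute)
    have "g x = 0" if "x \<in> vec.span B" for x
      using that
    proof (rule vec.linear_eq_0_on_span[OF g, rotated])
      show "g x = 0" if "x \<in> B" for x
        using gB that notin vec.span_base by (metis insertCI)
    qed
    then have "\<forall>s\<in>S. (?z v* A) $ s = 0"
      using B(3) by (auto simp: z image_subset_iff)
    moreover have "(?z v* A) $ c = 1"
      using gB by (simp add: z)
    ultimately show False
      using * by (metis zero_neq_one)
  qed
qed


section \<open>The isotropic matroid\<close>

lemma adjacency_matrix_commute: "adjacency_matrix E $ u $ w = adjacency_matrix E $ w $ u"
  by (simp add: adjacency_matrix_def insert_commute)

lemma symmetric_matrix_form:
  fixes A :: "'a::comm_semiring_1 ^ 'n ^ 'n"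
  assumes sym: "\<And>u w. A $ u $ w = A $ w $ u"
  shows "(\<Sum>w\<in>UNIV. x $ w * (A *v y) $ w) = (\<Sum>w\<in>UNIV. (A *v x) $ w * y $ w)"
proof -
  have "(\<Sum>w\<in>UNIV. x $ w * (A *v y) $ w) = (\<Sum>w\<in>UNIV. \<Sum>u\<in>UNIV. x $ w * (A $ w $ u * y $ u))"
    by (simp add: matrix_vector_mult_def sum_distrib_left)
  also have "\<dots> = (\<Sum>u\<in>UNIV. \<Sum>w\<in>UNIV. A $ u $ w * x $ w * y $ u)"
    by (subst sum.swap) (intro sum.cong refl, metis sym mult.assoc mult.commute)
  also have "\<dots> = (\<Sum>w\<in>UNIV. (A *v x) $ w * y $ w)"
    by (simp add: matrix_vector_mult_def sum_distrib_right)
  finally show ?thesis .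
qed

text \<open>These are the three nonzero linear forms on GF(2)^2, to be evaluated at the pairs
  \<open>(z $ w, (A *v z) $ w)\<close>.\<close>

primrec kind_pairing :: "column_kind \<Rightarrow> bit \<Rightarrow> bit \<Rightarrow> bit" where
  "kind_pairing Phi a b = a"
| "kind_pairing Chi a b = b"
| "kind_pairing Psi a b = a + b"

lemma kind_pairing_0_0 [simp]: "kind_pairing k 0 0 = 0"
  by (cases k) auto

lemma kind_pairing_add:
  "kind_pairing k (a + a') (b + b') = kind_pairing k a b + kind_pairing k a' b'"
  by (cases k) (auto simp: algebra_simps)

lemma kind_pairing_mult: "kind_pairing k (c * a) (c * b) = c * kind_pairing k a b"
  by (cases k) (auto simp: algebra_simps)

text \<open>The kernel of a nonzero form on the plane is a line, so two vectors in it have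
  determinant zero.\<close>

lemma kind_pairing_collinear:
  assumes "kind_pairing k a b = 0" "kind_pairing k a' b' = 0"
  shows "a * b' = b * a'"
  using assms by (cases k; cases a; cases b; cases a'; cases b') auto

text \<open>Symmetry of the adjacency matrix replaces the row product of \<open>z\<close> by
  \<open>A *v z\<close>.\<close>

lemma vector_matrix_mult_IAS:
  "(z v* IAS E) $ (w, k) = kind_pairing k (z $ w) ((adjacency_matrix E *v z) $ w)"
proof -
  have I: "(\<Sum>i\<in>UNIV. z $ i * mat 1 $ i $ w) = z $ w"
    using arg_cong[OF vector_matrix_mul_rid[of z], of "\<lambda>t. t $ w"]
    unfolding vector_matrix_mult_def vec_lambda_beta .
  have A: "(\<Sum>i\<in>UNIV. z $ i * adjacency_matrix E $ i $ w) = (adjacency_matrix E *v z) $ w"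
    unfolding matrix_vector_mult_def vec_lambda_beta
    by (intro sum.cong refl) (metis adjacency_matrix_commute mult.commute)
  show ?thesis
    by (cases k) (simp_all only: vector_matrix_mult_def IAS_def vec_lambda_beta case_prod_conv
        column_kind.case kind_pairing.simps vector_add_component distrib_left sum.distrib I A)
qed

lemma column_IAS:
  "column (w, Phi) (IAS E) = axis w 1"
  "column (w, Chi) (IAS E) = adjacency_matrix E *v axis w 1"
  "column (w, Psi) (IAS E) = axis w 1 + adjacency_matrix E *v axis w 1"
  by (simp_all add: vec_eq_iff column_def IAS_def mat_def axis_def matrix_vector_mult_basis
      matrix_vector_mult_def if_distrib cong: if_cong)

section \<open>Columns at \<open>v\<close> in the span of \<open>S\<close>\<close>

lemma some_column_in_span:
  fixes E :: "'v::finite set set"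
  assumes \<kappa>: "\<And>w. w \<noteq> v \<Longrightarrow> (w, \<kappa> w) \<in> S"
  shows "\<exists>k. column (v, k) (IAS E) \<in> vec.span ((\<lambda>c. column c (IAS E)) ` S)"
proof (rule ccontr)
  assume none: "\<nexists>k. column (v, k) (IAS E) \<in> vec.span ((\<lambda>c. column c (IAS E)) ` S)"
  let ?A = "adjacency_matrix E"
  let ?orth = "\<lambda>z. \<forall>s\<in>S. (z v* IAS E) $ s = 0"
  have ex: "\<exists>z. ?orth z \<and> kind_pairing k (z $ v) ((?A *v z) $ v) \<noteq> 0" for k
    using none by (auto simp: column_in_span_iff vector_matrix_mult_IAS)
  have collinear: "x $ v * (?A *v y) $ v = (?A *v x) $ v * y $ v"
    if x: "?orth x" and y: "?orth y" for x y
  proof -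
    \<comment> \<open>Both pairs at \<open>w\<close> are killed by the form of kind
      \<open>\<kappa> w\<close>; removing these equal terms from the symmetric form leaves the term
      at \<open>v\<close>.\<close>
    have "x $ w * (?A *v y) $ w = (?A *v x) $ w * y $ w" if "w \<noteq> v" for w
      using kind_pairing_collinear x y \<kappa>[OF that] vector_matrix_mult_IAS by metis
    then have "(\<Sum>w\<in>-{v}. x $ w * (?A *v y) $ w) = (\<Sum>w\<in>-{v}. (?A *v x) $ w * y $ w)"
      by (intro sum.cong) auto
    moreover have split: "(\<Sum>w\<in>UNIV. h w) = h v + (\<Sum>w\<in>-{v}. h w)" for h :: "'v \<Rightarrow> bit"
      by (simp add: sum.remove[of UNIV v] Compl_eq_Diff_UNIV)
    ultimately show ?thesis
      using symmetric_matrix_form[OF adjacency_matrix_commute, of x E y] by (simp only: split add_right_cancel)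
  qed
  \<comment> \<open>Collinearity of \<open>x\<close> and \<open>y\<close> forces both their pairs at
    \<open>v\<close> to be (1, 1). The pair of \<open>z\<close> is then a multiple of (1, 1), and
    its coordinates sum to 0.\<close>
  obtain x y z where "?orth x" "x $ v \<noteq> 0" "?orth y" "(?A *v y) $ v \<noteq> 0"
    "?orth z" "z $ v + (?A *v z) $ v \<noteq> 0"
    using ex[of Phi] ex[of Chi] ex[of Psi] by auto
  then show False
    using collinear[of x y] collinear[of x z] collinear[of y z]
    by (cases "x $ v"; cases "z $ v"; cases "(?A *v z) $ v"; cases "y $ v"; cases "(?A *v x) $ v") auto
qed

lemma not_both_columns_in_span:
  fixes E :: "'v::finite set set"
  assumes S: "\<And>w k. (w, k) \<in> S \<Longrightarrow> w \<noteq> v \<and> k = \<kappa> w"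
    and Phi: "column (v, Phi) (IAS E) \<in> vec.span ((\<lambda>c. column c (IAS E)) ` S)"
  shows "column (v, Chi) (IAS E) \<notin> vec.span ((\<lambda>c. column c (IAS E)) ` S)"
proof -
  let ?A = "adjacency_matrix E"
  \<comment> \<open>In a combination of columns from \<open>S\<close>, \<open>x\<close> collects the
    contributions of I and \<open>y\<close> those of A. The pair \<open>(y $ w, x $ w)\<close> is a
    multiple of (0, 1), (1, 0) or (1, 1) for kind \<open>Phi\<close>, \<open>Chi\<close> or
    \<open>Psi\<close>, which is exactly the kernel of the form.\<close>
  let ?P = "\<lambda>x y. x $ v = 0 \<and> y $ v = 0 \<and> (\<forall>w. w \<noteq> v \<longrightarrow> kind_pairing (\<kappa> w) (y $ w) (x $ w) = 0)"
  have "\<exists>x y. ?P x y \<and> column (v, Phi) (IAS E) = x + ?A *v y"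
    using Phi
  proof (induction rule: vec.span_induct)
    case base
    have add: "\<exists>x y. ?P x y \<and> s + t = x + ?A *v y"
      if "\<exists>x y. ?P x y \<and> s = x + ?A *v y" "\<exists>x y. ?P x y \<and> t = x + ?A *v y" for s t
    proof -
      obtain x y x' y' where "?P x y" "s = x + ?A *v y" "?P x' y'" "t = x' + ?A *v y'"
        using \<open>\<exists>x y. ?P x y \<and> s = x + ?A *v y\<close> \<open>\<exists>x y. ?P x y \<and> t = x + ?A *v y\<close> by blast
      then have "?P (x + x') (y + y')" "s + t = (x + x') + ?A *v (y + y')"
        by (auto simp only: vector_add_component kind_pairing_add matrix_vector_right_distrib
            add_0_left add.assoc add.left_commute simp_thms)
      then show ?thesis
        by blast
    qed
    have scale: "\<exists>x y. ?P x y \<and> c *s s = x + ?A *v y"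
      if "\<exists>x y. ?P x y \<and> s = x + ?A *v y" for c s
    proof -
      obtain x y where "?P x y" "s = x + ?A *v y"
        using \<open>\<exists>x y. ?P x y \<and> s = x + ?A *v y\<close> by blast
      then have "?P (c *s x) (c *s y)" "c *s s = c *s x + ?A *v (c *s y)"
        by (auto simp only: vector_smult_component kind_pairing_mult vector_scalar_commute
            vector_add_ldistrib mult_zero_right simp_thms)
      then show ?thesis
        by blast
    qed
    have zero: "\<exists>x y. ?P x y \<and> 0 = x + ?A *v y"
      by (intro exI[of _ 0]) simp
    show ?case
      unfolding vec.subspace_def mem_Collect_eq using add scale zero by blast
  next
    case (step c)
    then obtain w k where w: "(w, k) \<in> S" "c = column (w, k) (IAS E)"
      by auto
    then have "w \<noteq> v" "k = \<kappa> w"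
      using S by auto
    define x where "x = (if k = Chi then 0 else axis w 1 :: bit ^ 'v)"
    define y where "y = (if k = Phi then 0 else axis w 1 :: bit ^ 'v)"
    have "c = x + ?A *v y"
      using w(2) by (cases k) (auto simp: x_def y_def column_IAS)
    moreover have "?P x y"
      using \<open>w \<noteq> v\<close> \<open>k = \<kappa> w\<close> by (cases k) (auto simp: x_def y_def axis_def)
    ultimately show ?case
      by blast
  qed
  then obtain x y where P: "?P x y" and eq: "axis v 1 = x + ?A *v y"
    by (auto simp: column_IAS)
  have sum: "x $ w + (?A *v y) $ w = (if w = v then 1 else 0)" for w
    using arg_cong[OF eq, of "\<lambda>t. t $ w"] by (simp only: axis_def vec_lambda_beta vector_add_component)
  have bit: "b = a" if "a + b = 0" for a b :: bit
    using that by (cases a; cases b) auto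
  \<comment> \<open>Off \<open>v\<close>, \<open>A *v y\<close> agrees with \<open>x\<close> since
    signs vanish over GF(2). The last clause of \<open>?P\<close> thus says that \<open>y\<close> is
    orthogonal to \<open>S\<close>.\<close>
  have Ay: "(?A *v y) $ w = (if w = v then 1 else x $ w)" for w
    using sum[of w] bit[of "x $ w" "(?A *v y) $ w"] P by (metis add_0)
  have "\<forall>s\<in>S. (y v* IAS E) $ s = 0"
    using P by (auto simp: vector_matrix_mult_IAS Ay dest!: S)
  moreover have "(y v* IAS E) $ (v, Chi) = 1"
    by (simp add: vector_matrix_mult_IAS Ay)
  ultimately show ?thesis
    by (metis column_in_span_iff zero_neq_one)
qed

section \<open>Subtransversals as functions, and the rank count\<close>

text \<open>The first projection is injective on \<open>S\<close> and misses \<open>v\<close>, so by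
  cardinality its image is all of \<open>- {v}\<close>.\<close>

lemma subtransversal_eq_graph:
  fixes S :: "('v::finite \<times> column_kind) set"
  assumes "subtransversal S" "card S = CARD('v) - 1"
    and v: "(v, Phi) \<notin> S" "(v, Chi) \<notin> S" "(v, Psi) \<notin> S"
  obtains \<kappa> where "\<And>w k. (w, k) \<in> S \<longleftrightarrow> w \<noteq> v \<and> k = \<kappa> w"
proof -
  have unique: "k = k'" if "(w, k) \<in> S" "(w, k') \<in> S" for w k k'
  proof -
    let ?T = "S \<inter> {(w, Phi), (w, Chi), (w, Psi)}"
    have "(w, k) \<in> ?T" "(w, k') \<in> ?T"
      using that by (cases k; cases k'; simp)+
    moreover have "card ?T \<le> 1"
      using assms(1) by (simp add: subtransversal_def)
    ultimately show ?thesis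
      by (metis card_le_Suc0_iff_eq finite One_nat_def prod.inject)
  qed
  then have "inj_on fst S"
    by (auto simp: inj_on_def)
  then have "card (fst ` S) = card (- {v})"
    using assms(2) by (simp add: card_image Compl_eq_Diff_UNIV)
  moreover have not_v: "w \<noteq> v" if "(w, k) \<in> S" for w k
    using v that by (cases k) auto
  then have "fst ` S \<subseteq> - {v}"
    by fastforce
  ultimately have "fst ` S = - {v}"
    by (intro card_subset_eq) simp_all
  then have "\<exists>k. (w, k) \<in> S" if "w \<noteq> v" for w
    using that by (metis ComplI fst_conv imageE prod.collapse singletonD)
  then obtain \<kappa> where "\<And>w. w \<noteq> v \<Longrightarrow> (w, \<kappa> w) \<in> S"
    by metis
  then show thesis
    using unique not_v by (intro that[of \<kappa>]) blast
qed

theorem theorem41: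
  fixes E :: "'v::finite set set"
    and S :: "('v \<times> column_kind) set"
    and v :: 'v
  assumes "looped_simple_graph E"
    and "subtransversal S"
    and "card S = CARD('v) - 1"
    and "(v, Phi) \<notin> S" "(v, Chi) \<notin> S" "(v, Psi) \<notin> S"
  shows "\<exists>k. matroid_rank (M_IAS E) (S \<union> {(v, k)}) = matroid_rank (M_IAS E) S \<and>
    (\<forall>k'. k' \<noteq> k \<longrightarrow>
      matroid_rank (M_IAS E) (S \<union> {(v, k')}) = matroid_rank (M_IAS E) S + 1)"
proof -
  let ?U = "vec.span ((\<lambda>c. column c (IAS E)) ` S)"
  let ?c = "\<lambda>k. column (v, k) (IAS E)"
  obtain \<kappa> where \<kappa>: "\<And>w k. (w, k) \<in> S \<longleftrightarrow> w \<noteq> v \<and> k = \<kappa> w"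
    using subtransversal_eq_graph[OF assms(2-6)] by blast
  obtain k where k: "?c k \<in> ?U"
    using some_column_in_span[of v \<kappa> S E] \<kappa> by blast
  have not_both: "\<not> (?c Phi \<in> ?U \<and> ?c Chi \<in> ?U)"
    using not_both_columns_in_span[of S v \<kappa> E] \<kappa> by blast
  have double: "x + x = 0" for x :: "bit ^ 'v"
    by (simp add: vec_eq_iff)
  \<comment> \<open>The three columns at \<open>v\<close> sum to zero, so any two of them in the
    span would put both \<open>Phi\<close> and \<open>Chi\<close> there.\<close>
  have sums: "?c Psi = ?c Phi + ?c Chi" "?c Phi = ?c Chi + ?c Psi" "?c Chi = ?c Phi + ?c Psi"
    using double by (simp_all add: column_IAS add.left_commute flip: add.assoc)
  have "?c k' \<notin> ?U" if "k' \<noteq> k" for k'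
  proof
    assume k': "?c k' \<in> ?U"
    show False
      using that k k' not_both sums vec.span_add[of _ "(\<lambda>c. column c (IAS E)) ` S"]
      by (cases k; cases k') metis+
  qed
  then show ?thesis
    using k unfolding matroid_rank_column_matroid_insert by auto
qed

end
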